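(* Let $\mathcal{K}$ be a finite-dimensional complex Hilbert space with inner product $\langle\cdot,\cdot\rangle$, let $S$ be a strictly positive operator on $\mathcal{K}$, let $\mathcal{K}_0\subset\mathcal{K}$ be a linear subspace with basis $\{e_i\}_{i=1}^d$, and define $d\times d$ matrices $K^{(1)}_{ij}=\langle e_i,Se_j\rangle$, $K^{(2)}_{ij}=\langle e_i,e_j\rangle$, $K^{(3)}_{ij}=\langle e_i,S^{-1}e_j\rangle$. Then the following are equivalent: (i) $S(\mathcal{K}_0)=\mathcal{K}_0$; (ii) $(K^{(3)})^{-1}=(K^{(2)})^{-1}K^{(1)}(K^{(2)})^{-1}$. *)

theory Defs
  imports "HOL-Analysis.Analysis"
begin

text \<open>Standard inner product on the finite-dimensional complex Hilbert space complex^'n,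
  conjugate-linear in the first argument.\<close>
definition cinner :: "complex^'n \<Rightarrow> complex^'n \<Rightarrow> complex" where
  "cinner x y = (\<Sum>k\<in>UNIV. cnj (x $ k) * y $ k)"

text \<open>Strictly positive operator: the quadratic form is a strictly positive real
  number on every nonzero vector.\<close>
definition strictly_positive :: "complex^'n^'n \<Rightarrow> bool" where
  "strictly_positive S \<longleftrightarrow>
     (\<forall>x. x \<noteq> 0 \<longrightarrow> Im (cinner x (S *v x)) = 0 \<and> Re (cinner x (S *v x)) > 0)"

end

(*
  Let E be the matrix whose columns are the e_j, so that K0 is the column space of E and
  K1 = E* S E, K2 = E* E, K3 = E* S^-1 E.  As E is injective and S invertible, S K0 = K0
  amounts to S E = E M for some invertible M.  Then S^-1 E = E M^-1, K1 = K2 M and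
  K3 = K2 M^-1, hence K3 = K2 K1^-1 K2, which is (ii) after inversion.  Conversely, with
  N = K1^-1 K2 the residual G = S^-1 E - E N satisfies G* S G = K3 - K2 K1^-1 K2, so (ii)
  and the strict positivity of S force G = 0; thus S^-1 E = E N with N invertible, and
  K0 is S-invariant.
*)
theory Submission
  imports Defs
begin

definition ctranspose :: "complex^'n^'m \<Rightarrow> complex^'m^'n" where
  "ctranspose A = (\<chi> i j. cnj (A $ j $ i))"

lemma ctranspose_ctranspose [simp]: "ctranspose (ctranspose A) = A"
  by (simp add: vec_eq_iff ctranspose_def)

lemma ctranspose_matrix_mult: "ctranspose (A ** B) = ctranspose B ** ctranspose A"
  by (simp add: vec_eq_iff matrix_matrix_mult_def ctranspose_def cnj_sum mult.commute)

lemma ctranspose_diff: "ctranspose (A - B) = ctranspose A - ctranspose B"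
  by (simp add: vec_eq_iff ctranspose_def)

lemma cinner_add_left: "cinner (x + y) z = cinner x z + cinner y z"
  by (simp add: cinner_def sum.distrib ring_distribs)

lemma cinner_add_right: "cinner z (x + y) = cinner z x + cinner z y"
  by (simp add: cinner_def sum.distrib ring_distribs)

lemma cinner_scale_left: "cinner (c *s x) z = cnj c * cinner x z"
  by (simp add: cinner_def sum_distrib_left mult_ac)

lemma cinner_scale_right: "cinner z (c *s x) = c * cinner z x"
  by (simp add: cinner_def sum_distrib_left mult_ac)

lemma cinner_zero_left [simp]: "cinner 0 y = 0"
  by (simp add: cinner_def)

lemma cinner_zero_right [simp]: "cinner x 0 = 0"
  by (simp add: cinner_def)

lemma cinner_axis_left: "cinner (axis i 1) y = y $ i"
  by (simp add: cinner_def axis_def if_distrib if_distribR cong: if_cong)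

lemma cinner_self: "cinner x x = of_real ((norm x)\<^sup>2)"
proof -
  have "cinner x x = (\<Sum>k\<in>UNIV. of_real ((norm (x $ k))\<^sup>2))"
    unfolding cinner_def by (simp add: complex_norm_square mult.commute del: of_real_power)
  also have "\<dots> = of_real ((norm x)\<^sup>2)"
    by (simp add: norm_vec_def L2_set_def sum_nonneg)
  finally show ?thesis .
qed

lemma cinner_matrix_vector_mult: "cinner x (A *v y) = cinner (ctranspose A *v x) y"
proof -
  have "cinner x (A *v y) = (\<Sum>k\<in>UNIV. \<Sum>l\<in>UNIV. cnj (x $ k) * (A $ k $ l * y $ l))"
    by (simp add: cinner_def matrix_vector_mult_def sum_distrib_left)
  also have "\<dots> = (\<Sum>l\<in>UNIV. \<Sum>k\<in>UNIV. cnj (x $ k) * (A $ k $ l * y $ l))"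
    by (rule sum.swap)
  also have "\<dots> = cinner (ctranspose A *v x) y"
    by (simp add: cinner_def matrix_vector_mult_def ctranspose_def cnj_sum
        sum_distrib_left mult_ac)
  finally show ?thesis .
qed

lemma ctranspose_matrix_mult_nth:
  "(ctranspose A ** B) $ i $ j = cinner (column i A) (column j B)"
  by (simp add: matrix_matrix_mult_def ctranspose_def cinner_def column_def)

lemma matrix_vector_mult_axis: "A *v axis j 1 = column j (A :: 'a::semiring_1^_^_)"
  by (simp add: vec_eq_iff column_def matrix_vector_mult_def axis_def
      if_distrib if_distribR cong: if_cong)

lemma column_matrix_mult: "column j (A ** B) = A *v column j B"
  by (simp add: vec_eq_iff column_def matrix_matrix_mult_def matrix_vector_mult_def)

lemma matrix_diff_ldistrib: "A ** (B - C) = A ** B - A ** (C :: 'a::ring_1^_^_)"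
  by (simp add: vec_eq_iff matrix_matrix_mult_def sum_subtractf right_diff_distrib)

lemma matrix_diff_rdistrib: "(A - B) ** C = A ** C - B ** (C :: 'a::ring_1^_^_)"
  by (simp add: vec_eq_iff matrix_matrix_mult_def sum_subtractf left_diff_distrib)

lemma matrix_inv_left: "invertible A \<Longrightarrow> matrix_inv A ** A = mat 1"
  and matrix_inv_right: "invertible A \<Longrightarrow> A ** matrix_inv A = mat 1"
  unfolding invertible_def matrix_inv_def by (metis (mono_tags, lifting) someI_ex)+

lemma matrix_inv_unique:
  fixes A :: "'a::field^'n^'n"
  assumes "B ** A = mat 1"
  shows "matrix_inv A = B"
proof -
  have "invertible A"
    using assms invertible_left_inverse by blast
  then have "B = B ** (A ** matrix_inv A)"
    by (simp add: matrix_inv_right)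
  then show ?thesis
    by (simp add: matrix_mul_assoc assms)
qed

lemma invertible_matrix_inv: "invertible A \<Longrightarrow> invertible (matrix_inv A)"
  using matrix_inv_left matrix_inv_right invertible_def by blast

lemma matrix_inv_matrix_inv:
  fixes A :: "'a::field^'n^'n"
  shows "invertible A \<Longrightarrow> matrix_inv (matrix_inv A) = A"
  by (rule matrix_inv_unique) (rule matrix_inv_right)

lemma matrix_inv_mult:
  fixes A B :: "'a::field^'n^'n"
  assumes "invertible A" "invertible B"
  shows "matrix_inv (A ** B) = matrix_inv B ** matrix_inv A"
proof (rule matrix_inv_unique)
  have "matrix_inv B ** matrix_inv A ** (A ** B) = matrix_inv B ** (matrix_inv A ** A) ** B"
    by (simp add: matrix_mul_assoc)
  then show "matrix_inv B ** matrix_inv A ** (A ** B) = mat 1"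
    using assms by (simp add: matrix_inv_left)
qed

lemma matrix_inv_eq_iff:
  fixes A B :: "'a::field^'n^'n"
  assumes "invertible A" "invertible B"
  shows "matrix_inv A = B \<longleftrightarrow> A = matrix_inv B"
  using assms matrix_inv_matrix_inv by metis

lemma span_columns_eq_range:
  fixes A :: "'a::field^'d^'n"
  shows "vec.span (columns A) = range ((*v) A)"
proof
  have "columns A \<subseteq> range ((*v) A)"
    by (auto simp: columns_def simp flip: matrix_vector_mult_axis)
  then show "vec.span (columns A) \<subseteq> range ((*v) A)"
    by (metis vec.span_minimal vec.subspace_UNIV vec.subspace_image)
qed (auto intro: matrix_vector_mult_in_columnspace_gen)

lemma inj_matrix_vector_mult_if_independent_columns:
  fixes A :: "'a::field^'d^'n"
  assumes inj: "inj (\<lambda>j. column j A)"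
    and indep: "vec.independent (range (\<lambda>j. column j A))"
  shows "inj ((*v) A)"
  unfolding matrix_left_invertible_injective[symmetric] matrix_left_invertible_independent_columns
proof (intro allI impI)
  fix c assume "(\<Sum>j\<in>UNIV. c j *s column j A) = 0"
  then have "(\<Sum>v\<in>range (\<lambda>j. column j A). c (inv (\<lambda>j. column j A) v) *s v) = 0"
    by (simp add: sum.reindex[OF inj] inv_f_f[OF inj])
  then show "c j = 0" for j
    using indep by (auto simp: vec.independent_explicit inv_f_f[OF inj])
qed

lemma matrix_eq_iff_columns: "A = B \<longleftrightarrow> (\<forall>j. column j A = column j B)"
  by (simp add: vec_eq_iff column_def) blast

lemma range_matrix_vector_mult_mult:
  "range ((*v) (A ** B)) = (*v) A ` range ((*v) B)"
  by (simp add: image_image flip: matrix_vector_mul_assoc)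

lemma range_invertible_matrix_vector_mult:
  "invertible (A::'a::field^'n^'n) \<Longrightarrow> range ((*v) A) = UNIV"
  using invertible_right_inverse matrix_right_invertible_surjective by blast

lemma range_invariant_iff_intertwining:
  fixes S :: "'a::field^'n^'n" and E :: "'a^'d^'n"
  assumes S: "invertible S" and E: "inj ((*v) E)"
  shows "(*v) S ` range ((*v) E) = range ((*v) E) \<longleftrightarrow>
         (\<exists>M. invertible M \<and> S ** E = E ** M)"
proof
  assume invariant: "(*v) S ` range ((*v) E) = range ((*v) E)"
  have "\<forall>j. \<exists>c. S *v column j E = E *v c"
  proof
    fix j
    have "S *v column j E \<in> range ((*v) E)"
      using invariant by (auto simp flip: matrix_vector_mult_axis)
    then show "\<exists>c. S *v column j E = E *v c"
      by blast
  qed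
  then obtain c where c: "\<And>j. S *v column j E = E *v c j"
    by metis
  define M where "M = (\<chi> i j. c j $ i)"
  have SE: "S ** E = E ** M"
    by (simp add: matrix_eq_iff_columns column_matrix_mult c)
      (simp add: M_def column_def)
  have "x = 0" if "M *v x = 0" for x
  proof -
    have "matrix_inv S ** S ** E *v x = 0"
      by (simp add: SE that flip: matrix_mul_assoc matrix_vector_mul_assoc)
    then show "x = 0"
      using E by (simp add: matrix_inv_left S vec.inj_iff_eq_0)
  qed
  then have "invertible M"
    by (simp add: invertible_left_inverse matrix_left_invertible_ker)
  with SE show "\<exists>M. invertible M \<and> S ** E = E ** M"
    by blast
next
  assume "\<exists>M. invertible M \<and> S ** E = E ** M"
  then obtain M where M: "invertible M" and SE: "S ** E = E ** M"
    by blast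
  have "(*v) S ` range ((*v) E) = range ((*v) (E ** M))"
    by (simp add: range_matrix_vector_mult_mult flip: SE)
  also have "\<dots> = range ((*v) E)"
    by (simp add: range_matrix_vector_mult_mult range_invertible_matrix_vector_mult M)
  finally show "(*v) S ` range ((*v) E) = range ((*v) E)" .
qed

lemma strictly_positive_mat_1: "strictly_positive (mat 1)"
  by (simp add: strictly_positive_def cinner_self)

lemma strictly_positive_quadratic_form_eq_0_iff:
  "strictly_positive S \<Longrightarrow> cinner x (S *v x) = 0 \<longleftrightarrow> x = 0"
  unfolding strictly_positive_def by (cases "x = 0") force+

lemma cinner_matrix_vector_mult_swap_if_real:
  assumes real: "\<And>x. Im (cinner x (A *v x)) = 0"
  shows "cinner y (A *v x) = cnj (cinner x (A *v y))"
proof -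
  have polar: "cinner (x + c *s y) (A *v (x + c *s y)) = cinner x (A *v x)
      + c * cinner x (A *v y) + cnj c * cinner y (A *v x) + cnj c * c * cinner y (A *v y)" for c
    by (simp add: matrix_vector_right_distrib vector_scalar_commute cinner_add_left
        cinner_add_right cinner_scale_left cinner_scale_right algebra_simps)
  have "Im (cinner x (A *v y) + cinner y (A *v x)) = 0"
    using polar[of 1] real[of x] real[of y] real[of "x + 1 *s y"] by simp
  moreover have "Re (cinner x (A *v y) - cinner y (A *v x)) = 0"
    using polar[of \<i>] real[of x] real[of y] real[of "x + \<i> *s y"] by simp
  ultimately show ?thesis
    by (simp add: complex_eq_iff)
qed

lemma strictly_positive_hermitian:
  assumes "strictly_positive S"
  shows "ctranspose S = S"
proof -
  have "Im (cinner x (S *v x)) = 0" for x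
    using assms unfolding strictly_positive_def by (cases "x = 0") auto
  then have swap: "cinner (axis j 1) (S *v axis i 1) = cnj (cinner (axis i 1) (S *v axis j 1))"
    for i j
    by (rule cinner_matrix_vector_mult_swap_if_real)
  have entry: "cinner (axis i 1) (S *v axis j 1) = S $ i $ j" for i j
    by (simp add: cinner_axis_left matrix_vector_mult_axis column_def)
  have "cnj (S $ j $ i) = S $ i $ j" for i j
    using swap[of i j] unfolding entry by simp
  then show ?thesis
    by (simp add: vec_eq_iff ctranspose_def)
qed

lemma strictly_positive_imp_invertible:
  assumes "strictly_positive S"
  shows "invertible S"
  unfolding invertible_left_inverse matrix_left_invertible_ker
proof (intro allI impI)
  fix x assume "S *v x = 0"
  then have "cinner x (S *v x) = 0"
    by simp
  with assms show "x = 0"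
    by (simp add: strictly_positive_quadratic_form_eq_0_iff)
qed

lemma strictly_positive_matrix_inv:
  fixes S :: "complex^'n^'n"
  assumes S: "strictly_positive S"
  shows "strictly_positive (matrix_inv S)"
  unfolding strictly_positive_def
proof (intro allI impI)
  fix x :: "complex^'n" assume "x \<noteq> 0"
  define y where "y = matrix_inv S *v x"
  have x: "x = S *v y"
    using S by (simp add: y_def matrix_vector_mul_assoc matrix_inv_right
        strictly_positive_imp_invertible)
  with \<open>x \<noteq> 0\<close> have "y \<noteq> 0"
    by auto
  have "cinner x (matrix_inv S *v x) = cinner y (S *v y)"
    using strictly_positive_hermitian[OF S]
    by (metis x y_def cinner_matrix_vector_mult ctranspose_ctranspose)
  then show "Im (cinner x (matrix_inv S *v x)) = 0 \<and> 0 < Re (cinner x (matrix_inv S *v x))"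
    using S \<open>y \<noteq> 0\<close> by (simp add: strictly_positive_def)
qed

definition gram :: "complex^'d^'n \<Rightarrow> complex^'n^'n \<Rightarrow> complex^'d^'d" where
  "gram E A = ctranspose E ** A ** E"

lemma gram_nth: "gram E A $ i $ j = cinner (column i E) (A *v column j E)"
  by (simp add: gram_def ctranspose_matrix_mult_nth column_matrix_mult flip: matrix_mul_assoc)

lemma gram_mult_left: "gram (A ** E) S = gram E (ctranspose A ** S ** A)"
  by (simp add: gram_def ctranspose_matrix_mult matrix_mul_assoc)

lemma gram_mult_right: "gram (E ** M) S = ctranspose M ** gram E S ** M"
  by (simp add: gram_def ctranspose_matrix_mult matrix_mul_assoc)

lemma gram_diff:
  "gram (A - B) S = gram A S - ctranspose A ** S ** B - ctranspose B ** S ** A + gram B S"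
  by (simp add: gram_def ctranspose_diff matrix_diff_ldistrib matrix_diff_rdistrib)

lemma strictly_positive_gram:
  assumes S: "strictly_positive S" and E: "inj ((*v) E)"
  shows "strictly_positive (gram E S)"
proof -
  have "cinner x (gram E S *v x) = cinner (E *v x) (S *v (E *v x))" for x
    by (metis gram_def cinner_matrix_vector_mult ctranspose_ctranspose matrix_vector_mul_assoc)
  moreover have "E *v x \<noteq> 0" if "x \<noteq> 0" for x
    using E that vec.inj_iff_eq_0 by blast
  ultimately show ?thesis
    using S by (simp add: strictly_positive_def)
qed

lemma gram_eq_0_iff: "strictly_positive S \<Longrightarrow> gram G S = 0 \<longleftrightarrow> G = 0"
proof
  assume S: "strictly_positive S" and "gram G S = 0"
  then have "column j G = 0" for j
    using strictly_positive_quadratic_form_eq_0_iff gram_nth by (metis zero_index)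
  then show "G = 0"
    by (simp add: vec_eq_iff column_def)
qed (simp add: gram_def)

lemma gram_identity_if_intertwining:
  fixes S :: "complex^'n^'n" and E :: "complex^'d^'n"
  assumes E: "inj ((*v) E)" and S: "invertible S" and M: "invertible M"
    and SE: "S ** E = E ** M"
  shows "gram E (matrix_inv S) = gram E (mat 1) ** matrix_inv (gram E S) ** gram E (mat 1)"
proof -
  define K2 where "K2 = gram E (mat 1)"
  have K2: "invertible K2"
    unfolding K2_def
    by (intro strictly_positive_imp_invertible strictly_positive_gram strictly_positive_mat_1 E)
  have "matrix_inv S ** E = matrix_inv S ** (E ** M) ** matrix_inv M"
    by (simp add: matrix_inv_right M flip: matrix_mul_assoc)
  also have "\<dots> = E ** matrix_inv M"
    unfolding SE[symmetric] by (simp add: matrix_mul_assoc matrix_inv_left S)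
  finally have SiE: "matrix_inv S ** E = E ** matrix_inv M" .
  have K1: "gram E S = K2 ** M"
    by (simp add: K2_def gram_def SE flip: matrix_mul_assoc)
  have K3: "gram E (matrix_inv S) = K2 ** matrix_inv M"
    by (simp add: K2_def gram_def SiE flip: matrix_mul_assoc)
  have "K2 ** matrix_inv (K2 ** M) ** K2 = K2 ** matrix_inv M ** (matrix_inv K2 ** K2)"
    by (simp add: matrix_inv_mult K2 M matrix_mul_assoc)
  then show ?thesis
    unfolding K2_def[symmetric] K1 K3 by (simp add: matrix_inv_left K2)
qed

lemma gram_residual:
  fixes S :: "complex^'n^'n" and E :: "complex^'d^'n"
  assumes S: "strictly_positive S" and E: "inj ((*v) E)"
  defines "N \<equiv> matrix_inv (gram E S) ** gram E (mat 1)"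
  shows "gram (matrix_inv S ** E - E ** N) S = gram E (matrix_inv S) - gram E (mat 1) ** N"
proof -
  define Si K1 K2 where "Si = matrix_inv S" and "K1 = gram E S" and "K2 = gram E (mat 1)"
  have SSi: "S ** Si = mat 1" and SiS: "Si ** S = mat 1"
    using S by (simp_all add: Si_def matrix_inv_left matrix_inv_right
        strictly_positive_imp_invertible)
  have Si_adj: "ctranspose Si = Si"
    unfolding Si_def by (intro strictly_positive_hermitian strictly_positive_matrix_inv S)
  have K1: "strictly_positive K1"
    unfolding K1_def by (intro strictly_positive_gram S E)
  have K2_adj: "ctranspose K2 = K2"
    unfolding K2_def by (intro strictly_positive_hermitian strictly_positive_gram
        strictly_positive_mat_1 E)
  have N_adj: "ctranspose N = K2 ** matrix_inv K1"
    using strictly_positive_hermitian[OF strictly_positive_matrix_inv[OF K1]]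
    unfolding N_def K1_def[symmetric] K2_def[symmetric]
    by (simp add: ctranspose_matrix_mult K2_adj)
  have "gram (Si ** E) S = gram E Si"
    by (simp add: gram_mult_left Si_adj SiS)
  moreover have "ctranspose (Si ** E) ** S ** (E ** N) = K2 ** N"
  proof -
    have "ctranspose (Si ** E) ** S ** (E ** N) = ctranspose E ** (Si ** S) ** E ** N"
      by (simp add: ctranspose_matrix_mult Si_adj matrix_mul_assoc)
    then show ?thesis
      by (simp add: SiS K2_def gram_def)
  qed
  moreover have "ctranspose (E ** N) ** S ** (Si ** E) = K2 ** N"
  proof -
    have "ctranspose (E ** N) ** S ** (Si ** E)
        = ctranspose N ** (ctranspose E ** (S ** Si) ** E)"
      by (simp add: ctranspose_matrix_mult matrix_mul_assoc)
    also have "\<dots> = ctranspose N ** K2"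
      by (simp add: SSi K2_def gram_def)
    also have "\<dots> = K2 ** N"
      by (simp add: N_adj) (simp add: N_def K1_def K2_def matrix_mul_assoc)
    finally show ?thesis .
  qed
  moreover have "gram (E ** N) S = K2 ** N"
  proof -
    have "gram (E ** N) S = K2 ** (matrix_inv K1 ** K1) ** N"
      by (simp add: gram_mult_right N_adj K1_def matrix_mul_assoc)
    then show ?thesis
      using K1 by (simp add: matrix_inv_left strictly_positive_imp_invertible)
  qed
  ultimately show ?thesis
    by (simp add: gram_diff Si_def K2_def)
qed

lemma intertwining_if_gram_identity:
  fixes S :: "complex^'n^'n" and E :: "complex^'d^'n"
  assumes S: "strictly_positive S" and E: "inj ((*v) E)"
    and identity:
      "gram E (matrix_inv S) = gram E (mat 1) ** matrix_inv (gram E S) ** gram E (mat 1)"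
  shows "\<exists>M. invertible M \<and> S ** E = E ** M"
proof -
  define N where "N = matrix_inv (gram E S) ** gram E (mat 1)"
  have "gram (matrix_inv S ** E - E ** N) S = 0"
    using gram_residual[OF S E] identity by (simp add: N_def matrix_mul_assoc)
  then have "matrix_inv S ** E - E ** N = 0"
    using gram_eq_0_iff[OF S] by blast
  then have SiE: "matrix_inv S ** E = E ** N"
    by simp
  have N: "invertible N"
    unfolding N_def
    by (intro invertible_mult invertible_matrix_inv strictly_positive_imp_invertible
        strictly_positive_gram strictly_positive_mat_1 S E)
  have "S ** E = S ** (E ** N) ** matrix_inv N"
    by (simp add: matrix_inv_right N flip: matrix_mul_assoc)
  also have "\<dots> = E ** matrix_inv N"
    using S by (simp add: matrix_inv_right strictly_positive_imp_invertible matrix_mul_assoc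
        flip: SiE)
  finally show ?thesis
    using N invertible_matrix_inv by blast
qed

theorem lemma10:
  fixes S :: "complex^'n^'n" and e :: "'d::finite \<Rightarrow> complex^'n"
  assumes "strictly_positive S"
    and "inj e" and "vec.independent (range e)"
  defines "K0 \<equiv> vec.span (range e)"
    and "K1 \<equiv> (\<chi> i j. cinner (e i) (S *v e j)) :: complex^'d^'d"
    and "K2 \<equiv> (\<chi> i j. cinner (e i) (e j)) :: complex^'d^'d"
    and "K3 \<equiv> (\<chi> i j. cinner (e i) (matrix_inv S *v e j)) :: complex^'d^'d"
  shows "(\<lambda>x. S *v x) ` K0 = K0 \<longleftrightarrow>
         matrix_inv K3 = matrix_inv K2 ** K1 ** matrix_inv K2"
proof -
  define E :: "complex^'d^'n" where "E = (\<chi> k j. e j $ k)"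
  have column_E: "column j E = e j" for j
    by (simp add: vec_eq_iff E_def column_def)
  then have E: "inj ((*v) E)"
    using inj_matrix_vector_mult_if_independent_columns[of E] assms(2,3) by simp
  have "columns E = range e"
    by (auto simp: columns_def column_E)
  then have K0: "K0 = range ((*v) E)"
    by (simp add: K0_def flip: span_columns_eq_range)
  have K: "K1 = gram E S" "K2 = gram E (mat 1)" "K3 = gram E (matrix_inv S)"
    by (simp_all add: K1_def K2_def K3_def vec_eq_iff gram_nth column_E)
  have S: "strictly_positive S" "invertible S"
    using assms(1) strictly_positive_imp_invertible by blast+
  have invertible: "invertible K1" "invertible K2" "invertible K3"
    unfolding K by (intro strictly_positive_imp_invertible strictly_positive_gram E
        strictly_positive_mat_1 strictly_positive_matrix_inv S)+
  have "(\<lambda>x. S *v x) ` K0 = K0 \<longleftrightarrow> (\<exists>M. invertible M \<and> S ** E = E ** M)"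
    using range_invariant_iff_intertwining[OF S(2) E] by (simp add: K0)
  also have "\<dots> \<longleftrightarrow> K3 = K2 ** matrix_inv K1 ** K2"
    using gram_identity_if_intertwining[OF E S(2)] intertwining_if_gram_identity[OF S(1) E]
    unfolding K by blast
  also have "\<dots> \<longleftrightarrow> matrix_inv K3 = matrix_inv K2 ** K1 ** matrix_inv K2"
    using invertible by (simp add: matrix_inv_eq_iff matrix_inv_mult invertible_mult
        invertible_matrix_inv matrix_inv_matrix_inv matrix_mul_assoc)
  finally show ?thesis .
qed

end
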